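(* Let $(I,\mathcal T)$ be a finite tree rooted at $r$, let $U$ be a tree matrix on $I$ with associated $q$-matrix $Q$, and let $(X_t:0\le t<\zeta)$ be the continuous-time Markov chain on $I$ with infinitesimal generator $Q$ and lifetime $\zeta$. Then $U$ is the potential matrix of $(X_t:0\le t<\zeta)$, that is $$U=\int_0^\infty e^{tQ}\,dt,\qquad\text{equivalently}\qquad U_{ij}=\mathbb E_i\Big(\int_0^\infty \mathbf 1_{\{X_t=j\}}\,dt\Big)\quad\text{for all } i,j\in I.$$
   Context: For a tree rooted at $r$: $|i|$ is the length of the geodesic from $i$ to $r$; $i\wedge j$ is the common vertex of the geodesics from $r$ to $i$ and from $r$ to $j$ that is farthest from $r$; for $i\neq r$, $i^-$ is the neighbour of $i$ that is closer to $r$; $S_i=\{j: j^-=i\}$ is the set of successors of $i$ (possibly empty). Let $w:\{|i|:i\in I\}\to(0,\infty)$ be strictly increasing and put $w_{-1}=0$. The tree matrix is $U_{ij}=w_{|i\wedge j|}$, $i,j\in I$. The associated symmetric matrix $Q$ is given by $Q_{ii^-}=Q_{i^-i}=(w_{|i|}-w_{|i|-1})^{-1}$ for $i\ne r$; $Q_{ii}=-\big((w_{|i|}-w_{|i|-1})^{-1}+|S_i|(w_{|i|+1}-w_{|i|})^{-1}\big)$ (the second term being absent if $S_i=\emptyset$); and $Q_{ij}=0$ otherwise. All row sums of $Q$ are $0$ except that of $r$, which is $-1/w_0$; the chain $X$ is killed from $r$ at rate $1/w_0$, the killing time being $\zeta$, and by convention $X_t\notin I$ for $t\ge\zeta$.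 *)

theory Defs
  imports "HOL-Probability.Probability"
begin

section \<open>Finite rooted trees\<close>

text \<open>
  The vertex set $I$ is the finite type \<open>'v\<close>, and the edges form a symmetric irreflexive
  relation \<open>T\<close> on it. Walks and cycles are lists of vertices.
\<close>

definition is_walk :: "('v \<times> 'v) set \<Rightarrow> 'v \<Rightarrow> 'v \<Rightarrow> 'v list \<Rightarrow> bool" where
  "is_walk T i j p \<longleftrightarrow>
     p \<noteq> [] \<and> hd p = i \<and> last p = j \<and> successively (\<lambda>x y. (x, y) \<in> T) p"

definition is_cycle :: "('v \<times> 'v) set \<Rightarrow> 'v list \<Rightarrow> bool" where
  "is_cycle T p \<longleftrightarrow>
     3 \<le> length p \<and> distinct p \<and> successively (\<lambda>x y. (x, y) \<in> T) p \<and> (last p, hd p) \<in> T"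

definition is_tree :: "('v \<times> 'v) set \<Rightarrow> bool" where
  "is_tree T \<longleftrightarrow>
     sym T \<and> irrefl T \<and> (\<forall>i j. \<exists>p. is_walk T i j p) \<and> (\<nexists>p. is_cycle T p)"

text \<open>The shortest walk, which is unique in a tree.\<close>

definition geodesic :: "('v \<times> 'v) set \<Rightarrow> 'v \<Rightarrow> 'v \<Rightarrow> 'v list" where
  "geodesic T i j = (THE p. is_arg_min length (is_walk T i j) p)"

text \<open>$|i|$: a walk with $n$ edges has $n + 1$ vertices.\<close>

definition depth :: "('v \<times> 'v) set \<Rightarrow> 'v \<Rightarrow> 'v \<Rightarrow> nat" where
  "depth T r i = length (geodesic T i r) - 1"

text \<open>$i \wedge j$\<close>

definition meet :: "('v \<times> 'v) set \<Rightarrow> 'v \<Rightarrow> 'v \<Rightarrow> 'v \<Rightarrow> 'v" where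
  "meet T r i j =
     (THE k. is_arg_max (depth T r) (\<lambda>k. k \<in> set (geodesic T r i) \<inter> set (geodesic T r j)) k)"

text \<open>$i^-$, meaningful for $i \neq r$ only\<close>

definition parent :: "('v \<times> 'v) set \<Rightarrow> 'v \<Rightarrow> 'v \<Rightarrow> 'v" where
  "parent T r i = (THE k. (i, k) \<in> T \<and> depth T r k < depth T r i)"

definition succs :: "('v \<times> 'v) set \<Rightarrow> 'v \<Rightarrow> 'v \<Rightarrow> 'v set" where
  "succs T r i = {j. j \<noteq> r \<and> parent T r j = i}"


section \<open>Tree matrices and their $q$-matrices\<close>

text \<open>Only the values of \<open>w\<close> on the levels $\{|i| : i \in I\}$ are constrained and used.\<close>

definition level_weight :: "('v \<times> 'v) set \<Rightarrow> 'v \<Rightarrow> (nat \<Rightarrow> real) \<Rightarrow> bool" where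
  "level_weight T r w \<longleftrightarrow>
     (\<forall>n \<in> range (depth T r). 0 < w n) \<and> strict_mono_on (range (depth T r)) w"

definition tree_matrix :: "('v::finite \<times> 'v) set \<Rightarrow> 'v \<Rightarrow> (nat \<Rightarrow> real) \<Rightarrow> real^'v^'v" where
  "tree_matrix T r w = (\<chi> i j. w (depth T r (meet T r i j)))"

text \<open>$w_n - w_{n-1}$ with the convention $w_{-1} = 0$\<close>

definition incr :: "(nat \<Rightarrow> real) \<Rightarrow> nat \<Rightarrow> real" where
  "incr w n = w n - (if n = 0 then 0 else w (n - 1))"

definition tree_q_matrix :: "('v::finite \<times> 'v) set \<Rightarrow> 'v \<Rightarrow> (nat \<Rightarrow> real) \<Rightarrow> real^'v^'v" where
  "tree_q_matrix T r w = (\<chi> i j.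
     if i = j then
       - (inverse (incr w (depth T r i)) +
          (if succs T r i = {} then 0
           else real (card (succs T r i)) * inverse (incr w (depth T r i + 1))))
     else if i \<noteq> r \<and> j = parent T r i then inverse (incr w (depth T r i))
     else if j \<noteq> r \<and> i = parent T r j then inverse (incr w (depth T r j))
     else 0)"


section \<open>The matrix exponential\<close>

definition mexp :: "real^'v^'v \<Rightarrow> real^'v^'v" where
  "mexp A = (\<Sum>k. (1 / fact k) *\<^sub>R (((**) A) ^^ k) (mat 1))"


section \<open>Continuous-time Markov chains with a lifetime\<close>

text \<open>
  \<open>P i\<close> is the law of the chain started at \<open>i\<close>, all of these on one measurable space. The
  value \<open>None\<close> is the cemetery: \<open>X t \<omega> = None\<close> renders $X_t \notin I$, and \<open>X t\<close> matters for
  $t \ge 0$ only. The paths are right-continuous for the discrete topology. The Markov property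
  is the defining property of the conditional probability
  $P_i(X_{s+t} = j \mid \mathcal F_s) = P_{X_s}(X_t = j)$ on $\{X_s \in I\}$, with $\mathcal F$
  the natural filtration. The generator is the right derivative at $0$ of the transition function
  $p_t(i,j) = P_i(X_t = j)$ on $I$.
\<close>

definition past :: "'w set \<Rightarrow> (real \<Rightarrow> 'w \<Rightarrow> 'b) \<Rightarrow> real \<Rightarrow> 'w set set" where
  "past \<Omega> X s = sigma_sets \<Omega> {X u -` B \<inter> \<Omega> |u B. 0 \<le> u \<and> u \<le> s}"

locale ctmc =
  fixes P :: "'v::finite \<Rightarrow> 'w measure"
    and X :: "real \<Rightarrow> 'w \<Rightarrow> 'v option"
    and \<zeta> :: "'w \<Rightarrow> ennreal"
    and Q :: "real^'v^'v"
  assumes prob: "prob_space (P i)"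
    and same_space: "sets (P i) = sets (P j)"
    and random_variable: "0 \<le> t \<Longrightarrow> X t \<in> measurable (P i) (count_space UNIV)"
    and right_continuous:
      "\<lbrakk>0 \<le> t; \<omega> \<in> space (P i)\<rbrakk> \<Longrightarrow> \<forall>\<^sub>F s in at_right t. X s \<omega> = X t \<omega>"
    and lifetime:
      "\<lbrakk>0 \<le> t; \<omega> \<in> space (P i)\<rbrakk> \<Longrightarrow> X t \<omega> = None \<longleftrightarrow> \<zeta> \<omega> \<le> ennreal t"
    and start: "AE \<omega> in P i. X 0 \<omega> = Some i"
    and markov:
      "\<lbrakk>0 \<le> s; 0 \<le> t; A \<in> past (space (P i)) X s\<rbrakk> \<Longrightarrow>
       measure (P i) {\<omega> \<in> A. X s \<omega> = Some k \<and> X (s + t) \<omega> = Some j} =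
       measure (P i) {\<omega> \<in> A. X s \<omega> = Some k} *
       measure (P k) {\<omega> \<in> space (P k). X t \<omega> = Some j}"
    and generator:
      "((\<lambda>t. (measure (P i) {\<omega> \<in> space (P i). X t \<omega> = Some j} - (if i = j then 1 else 0)) / t)
         \<longlongrightarrow> Q $ i $ j) (at_right 0)"

end

theory Submission
  imports Defs
begin

text \<open>
  If \<open>i\<close> is not the root, then \<open>U\<^sub>i\<^sub>j\<close> exceeds the entry of the parent of \<open>i\<close> by
  $w_{|i|} - w_{|i|-1}$ when \<open>i\<close> lies on the geodesic from \<open>r\<close> to \<open>j\<close>, and equals it otherwise.
  As a proper ancestor of \<open>j\<close> has exactly one successor on that geodesic, \<open>Q U = - 1\<close>.
  Hence \<open>- e\<^sup>t\<^sup>Q U\<close> is a primitive of \<open>e\<^sup>t\<^sup>Q\<close>. The latter is nonnegative because \<open>Q\<close> is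
  so off the diagonal, and it tends to \<open>0\<close> because \<open>U\<close> is positive; integration gives \<open>U\<close>.
  By Chapman-Kolmogorov the transition function of the chain solves \<open>p' = p Q\<close>, whose only
  solution with \<open>p\<^sub>0 = 1\<close> is \<open>e\<^sup>t\<^sup>Q\<close>, and Tonelli's theorem turns the integral of \<open>p\<close> into
  expected occupation times.
\<close>

section \<open>Rooted trees\<close>

lemma is_walk_Cons:
  assumes "(i, k) \<in> T" "is_walk T k j p"
  shows "is_walk T i j (i # p)"
  using assms by (auto simp: is_walk_def successively_Cons)

lemma is_walk_cases:
  assumes "is_walk T i j p"
  obtains "p = [i]" "i = j"
  | k q where "p = i # q" "(i, k) \<in> T" "is_walk T k j q"
  using assms by (cases p) (auto simp: is_walk_def successively_Cons split: if_splits)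

lemma is_walk_rev:
  assumes "sym T"
  shows "is_walk T j i (rev p) \<longleftrightarrow> is_walk T i j p"
  using assms by (auto simp: is_walk_def hd_rev last_rev sym_def conj_commute)
    (auto elim!: successively_mono)

locale rooted_tree =
  fixes T :: "('v::finite \<times> 'v) set" and r :: 'v
  assumes tree: "is_tree T"
begin

text \<open>The distance to the root, available before geodesics are known to be unique;
  \<open>depth\<close> rests on a definite description and is identified with it in
  \<open>depth_eq\<close>.\<close>

definition height :: "'v \<Rightarrow> nat" where
  "height i = (LEAST n. \<exists>p. is_walk T i r p \<and> length p = Suc n)"

lemma edges_sym: "sym T" and no_cycle: "\<not> is_cycle T p"
  using tree by (auto simp: is_tree_def)

lemma ex_height_walk: "\<exists>p. is_walk T i r p \<and> length p = Suc (height i)"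
  unfolding height_def
proof (rule LeastI_ex)
  obtain p where "is_walk T i r p" using tree unfolding is_tree_def by blast
  then show "\<exists>n p. is_walk T i r p \<and> length p = Suc n"
    by (intro exI[of _ "length p - 1"] exI[of _ p]) (auto simp: is_walk_def)
qed

lemma height_less_length:
  assumes "is_walk T i r p"
  shows "height i < length p"
proof -
  have "Suc (length p - 1) = length p" using assms by (auto simp: is_walk_def)
  then have "height i \<le> length p - 1" unfolding height_def
    using assms by (intro Least_le) auto
  then show ?thesis using \<open>Suc (length p - 1) = length p\<close> by linarith
qed

lemma height_root [simp]: "height r = 0"
  using height_less_length[of r "[r]"] by (simp add: is_walk_def)

lemma height_edge: "(i, k) \<in> T \<Longrightarrow> height i \<le> Suc (height k)"
  using ex_height_walk[of k] is_walk_Cons[of i k T r] height_less_length[of i] by fastforce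

text \<open>The second vertex of a shortest walk will do: the rest of the walk bounds its height
  from above, and \<open>height_edge\<close> bounds it from below.\<close>

lemma ex_lower_neighbour:
  assumes "i \<noteq> r"
  shows "\<exists>k. (i, k) \<in> T \<and> height i = Suc (height k)"
proof -
  obtain p where p: "is_walk T i r p" "length p = Suc (height i)" using ex_height_walk by blast
  from p(1) show ?thesis
  proof (cases rule: is_walk_cases)
    case (2 k q)
    then have "Suc (height k) \<le> height i" using height_less_length[of k q] p(2) by simp
    then show ?thesis using 2 height_edge by (intro exI[of _ k]) (simp add: le_antisym)
  qed (use assms in simp)
qed

lemma height_0_iff [simp]: "height i = 0 \<longleftrightarrow> i = r"
  using ex_lower_neighbour[of i] by (cases "i = r") auto

text \<open>Descend one level from both ends; the two lower vertices coincide or are joined by the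
  induction hypothesis. The height bound keeps the new ends off the old path, so vertices stay
  distinct.\<close>

lemma ex_path_below:
  assumes "height k = m" "height k' = m" "k \<noteq> k'"
  shows "\<exists>p. is_walk T k k' p \<and> distinct p \<and> (\<forall>x\<in>set p. height x \<le> m)"
  using assms
proof (induction m arbitrary: k k')
  case 0
  then show ?case by simp
next
  case (Suc m)
  then have "k \<noteq> r" "k' \<noteq> r" by auto
  then obtain a b where a: "(k, a) \<in> T" "height a = m" and b: "(k', b) \<in> T" "height b = m"
    using ex_lower_neighbour Suc.prems by (metis Suc_inject)
  have b': "(b, k') \<in> T" using b edges_sym by (auto simp: sym_def)
  show ?case
  proof (cases "a = b")
    case True
    then show ?thesis using a b' Suc.prems
      by (intro exI[of _ "[k, a, k']"]) (auto simp: is_walk_def)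
  next
    case False
    then obtain p where p: "is_walk T a b p" "distinct p" "\<forall>x\<in>set p. height x \<le> m"
      using Suc.IH a b by blast
    then have "k \<notin> set p" "k' \<notin> set p" using Suc.prems by force+
    moreover have "is_walk T k k' (k # p @ [k'])"
      using p(1) a b' by (auto simp: is_walk_def successively_append_iff successively_Cons)
    ultimately show ?thesis using p Suc.prems
      by (intro exI[of _ "k # p @ [k']"]) (auto intro: le_SucI)
  qed
qed

text \<open>Acyclicity enters here. Two lower neighbours of \<open>i\<close> would lie on the same
  level, and a path joining them at or below that level closes up through \<open>i\<close> to a
  cycle.\<close>

lemma lower_neighbour_unique:
  assumes "(i, k) \<in> T" "(i, k') \<in> T" "height k < height i" "height k' < height i"
  shows "k = k'"
proof (rule ccontr)
  assume "k \<noteq> k'"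
  have "height i = Suc (height k)" "height k' = height k"
    using assms height_edge[of i k] height_edge[of i k'] by auto
  then obtain p where p: "is_walk T k k' p" "distinct p" "\<forall>x\<in>set p. height x \<le> height k"
    using ex_path_below \<open>k \<noteq> k'\<close> by blast
  \<comment> \<open>Together with \<open>i\<close> this gives the three vertices that a cycle must
    have.\<close>
  have "length p \<ge> 2"
    using p(1) \<open>k \<noteq> k'\<close> by (cases p; cases "tl p") (auto simp: is_walk_def)
  moreover have "i \<notin> set p" using p(3) assms(3) by auto
  moreover have "(k', i) \<in> T" using assms(2) edges_sym by (auto simp: sym_def)
  ultimately have "is_cycle T (i # p)"
    using p assms(1) by (auto simp: is_cycle_def is_walk_def successively_Cons)
  then show False using no_cycle by blast
qed

lemma is_arg_min_walk_iff:
  "is_arg_min length (is_walk T i r) p \<longleftrightarrow> is_walk T i r p \<and> length p = Suc (height i)"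
proof
  assume "is_arg_min length (is_walk T i r) p"
  then show "is_walk T i r p \<and> length p = Suc (height i)"
    using ex_height_walk[of i] height_less_length[of i p]
    by (metis Suc_leI is_arg_min_linorder le_antisym)
next
  assume "is_walk T i r p \<and> length p = Suc (height i)"
  then show "is_arg_min length (is_walk T i r) p"
    using height_less_length[of i] by (auto simp: is_arg_min_linorder Suc_le_eq)
qed

text \<open>The second vertices of both walks are lower neighbours of \<open>i\<close>, hence equal,
  and the induction hypothesis applies to the remaining walks.\<close>

lemma shortest_walk_unique:
  assumes "is_walk T i r p" "length p = Suc (height i)" "is_walk T i r q" "length q = Suc (height i)"
  shows "p = q"
  using assms
proof (induction "height i" arbitrary: i p q)
  case 0
  then show ?case
    by (cases p; cases q) (auto simp: is_walk_def)
next
  case (Suc n)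
  then have "i \<noteq> r" by auto
  obtain k p' where p: "p = i # p'" "(i, k) \<in> T" "is_walk T k r p'"
    using Suc.prems(1) \<open>i \<noteq> r\<close> by (cases rule: is_walk_cases) auto
  obtain l q' where q: "q = i # q'" "(i, l) \<in> T" "is_walk T l r q'"
    using Suc.prems(3) \<open>i \<noteq> r\<close> by (cases rule: is_walk_cases) auto
  have k: "height k < height i" and l: "height l < height i"
    using height_less_length[OF p(3)] height_less_length[OF q(3)] p(1) q(1) Suc.prems by auto
  with p q have "k = l" by (blast intro: lower_neighbour_unique)
  moreover have "height i = Suc (height k)" using k height_edge[OF p(2)] by simp
  ultimately show ?case using Suc.hyps Suc.prems p q by auto
qed

lemma geodesic_to_root: "is_walk T i r (geodesic T i r)" "length (geodesic T i r) = Suc (height i)"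
proof -
  have "\<exists>!p. is_walk T i r p \<and> length p = Suc (height i)"
    using ex_height_walk shortest_walk_unique by blast
  then have "is_walk T i r (geodesic T i r) \<and> length (geodesic T i r) = Suc (height i)"
    unfolding geodesic_def is_arg_min_walk_iff by (rule theI')
  then show "is_walk T i r (geodesic T i r)" "length (geodesic T i r) = Suc (height i)" by auto
qed

lemma depth_eq: "depth T r = height"
  by (auto simp: depth_def geodesic_to_root)

lemma parent_edge:
  assumes "i \<noteq> r"
  shows "(i, parent T r i) \<in> T" "height i = Suc (height (parent T r i))"
proof -
  have "\<exists>!k. (i, k) \<in> T \<and> height k < height i"
    using ex_lower_neighbour[OF assms] lower_neighbour_unique by (metis lessI)
  then have "(i, parent T r i) \<in> T \<and> height (parent T r i) < height i"
    unfolding parent_def depth_eq by (rule theI')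
  then show "(i, parent T r i) \<in> T" "height i = Suc (height (parent T r i))"
    using height_edge[of i "parent T r i"] by auto
qed

lemma tree_induct [case_names root child]:
  assumes "P r" "\<And>i. i \<noteq> r \<Longrightarrow> P (parent T r i) \<Longrightarrow> P i"
  shows "P i"
proof (induction "height i" arbitrary: i)
  case 0
  then show ?case using assms(1) by simp
next
  case (Suc n)
  then have "i \<noteq> r" by auto
  then show ?case using Suc assms(2) parent_edge(2) by simp
qed

lemma geodesic_root: "geodesic T r r = [r]"
  using geodesic_to_root[of r] by (cases "geodesic T r r") (auto simp: is_walk_def)

lemma geodesic_step:
  assumes "i \<noteq> r"
  shows "geodesic T i r = i # geodesic T (parent T r i) r"
  using assms by (intro shortest_walk_unique[of i])
    (auto simp: geodesic_to_root parent_edge(2) intro: is_walk_Cons[OF parent_edge(1)])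

text \<open>\<open>depth\<close> uses walks to the root and \<open>meet\<close> walks from it.
  Reversal preserves lengths and exchanges the two kinds, so uniqueness carries over.\<close>

lemma geodesic_from_root: "geodesic T r i = rev (geodesic T i r)"
proof -
  have "is_arg_min length (is_walk T r i) = (\<lambda>p. is_arg_min length (is_walk T i r) (rev p))"
    unfolding is_arg_min_linorder is_walk_rev[OF edges_sym] fun_eq_iff
    by (metis is_walk_rev[OF edges_sym] length_rev rev_rev_ident)
  moreover have "rev p = geodesic T i r" if "is_walk T i r (rev p)" "length p = Suc (height i)" for p
    using that geodesic_to_root[of i] by (intro shortest_walk_unique[of i]) auto
  ultimately show ?thesis
    unfolding geodesic_def[of T r i] is_arg_min_walk_iff
    using geodesic_to_root[of i] by (intro the_equality) auto
qed

section \<open>Ancestors and meets\<close>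

definition ancestors :: "'v \<Rightarrow> 'v set" where
  "ancestors i = set (geodesic T r i)"

lemma ancestors_root: "ancestors r = {r}"
  by (simp add: ancestors_def geodesic_root)

lemma ancestors_step: "i \<noteq> r \<Longrightarrow> ancestors i = insert i (ancestors (parent T r i))"
  by (simp add: ancestors_def geodesic_from_root geodesic_step)

lemma root_in_ancestors: "r \<in> ancestors i"
  by (induction i rule: tree_induct) (auto simp: ancestors_root ancestors_step)

lemma self_in_ancestors: "i \<in> ancestors i"
  by (cases "i = r") (auto simp: ancestors_root ancestors_step)

lemma height_ancestor_le: "k \<in> ancestors i \<Longrightarrow> height k \<le> height i"
  by (induction i rule: tree_induct) (auto simp: ancestors_root ancestors_step parent_edge)

lemma ancestors_trans: "k \<in> ancestors i \<Longrightarrow> ancestors k \<subseteq> ancestors i"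
  by (induction i rule: tree_induct) (auto simp: ancestors_root ancestors_step)

text \<open>Each step to a child adds one vertex above all earlier levels. With one ancestor per
  level, the maximal common ancestor in \<open>meet\<close> is unique.\<close>

lemma inj_on_height_ancestors: "inj_on height (ancestors i)"
proof (induction i rule: tree_induct)
  case root
  then show ?case by (simp add: ancestors_root)
next
  case (child i)
  have "height i \<notin> height ` ancestors (parent T r i)"
    using height_ancestor_le[of _ "parent T r i"] parent_edge(2)[OF child.hyps] by fastforce
  then show ?case using child by (auto simp: ancestors_step inj_on_insert)
qed

lemma meet_eqI:
  assumes "k \<in> ancestors i" "k \<in> ancestors j"
    and "\<And>l. l \<in> ancestors i \<Longrightarrow> l \<in> ancestors j \<Longrightarrow> height l \<le> height k"
  shows "meet T r i j = k"
  unfolding meet_def depth_eq ancestors_def[symmetric]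
proof (rule the_equality)
  show "is_arg_max height (\<lambda>k. k \<in> ancestors i \<inter> ancestors j) k"
    using assms by (auto simp: is_arg_max_linorder)
next
  fix l assume "is_arg_max height (\<lambda>k. k \<in> ancestors i \<inter> ancestors j) l"
  then have "l \<in> ancestors i" "l \<in> ancestors j" "height l = height k"
    using assms by (auto simp: is_arg_max_linorder intro: le_antisym)
  then show "l = k" using inj_on_height_ancestors[of i] assms(1) by (auto dest: inj_onD)
qed

lemma meet_ancestor: "i \<in> ancestors j \<Longrightarrow> meet T r i j = i"
  by (rule meet_eqI) (auto simp: self_in_ancestors height_ancestor_le)

lemma meet_parent:
  assumes "i \<noteq> r" "i \<notin> ancestors j"
  shows "meet T r i j = meet T r (parent T r i) j"
proof -
  have "ancestors i \<inter> ancestors j = ancestors (parent T r i) \<inter> ancestors j"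
    using assms by (auto simp: ancestors_step)
  then show ?thesis unfolding meet_def ancestors_def[symmetric] by simp
qed

lemma parent_in_ancestors: "i \<noteq> r \<Longrightarrow> parent T r i \<in> ancestors i"
  by (simp add: ancestors_step self_in_ancestors)

text \<open>Induction along the path to \<open>j\<close>: passing from the parent of
  \<open>j\<close> to \<open>j\<close> adds \<open>of_bool (i = j)\<close> to the left side, while
  on the right the term for \<open>i = j\<close> replaces the one for \<open>i\<close> being that
  parent, which reappears as the new successor \<open>j\<close> in the sum.\<close>

lemma of_bool_ancestor:
  "(of_bool (i \<in> ancestors j) :: real) =
     of_bool (i = j) + (\<Sum>c\<in>succs T r i. of_bool (c \<in> ancestors j))"
proof (induction j rule: tree_induct)
  case root
  have "(\<Sum>c\<in>succs T r i. of_bool (c \<in> ancestors r)) = (0::real)"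
    by (intro sum.neutral) (auto simp: succs_def ancestors_root)
  then show ?case by (simp add: ancestors_root)
next
  case (child j)
  let ?p = "parent T r j"
  \<comment> \<open>Ancestors are never higher than the vertex itself; this makes the two indicators
    for old and new ancestors disjoint, so that they add up.\<close>
  have j: "j \<notin> ancestors ?p" using height_ancestor_le[of j ?p] parent_edge(2)[of j] child by auto
  have "(\<Sum>c\<in>succs T r i. of_bool (c \<in> ancestors j)) =
      (\<Sum>c\<in>succs T r i. of_bool (c \<in> ancestors ?p) + (of_bool (c = j) :: real))"
    using j by (intro sum.cong) (auto simp: ancestors_step child)
  also have "\<dots> = (\<Sum>c\<in>succs T r i. of_bool (c \<in> ancestors ?p)) + of_bool (j \<in> succs T r i)"
    by (simp add: sum.distrib of_bool_def)
  finally have "(\<Sum>c\<in>succs T r i. of_bool (c \<in> ancestors j)) =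
      (\<Sum>c\<in>succs T r i. of_bool (c \<in> ancestors ?p)) + (of_bool (j \<in> succs T r i) :: real)" .
  moreover have "of_bool (j \<in> succs T r i) = (of_bool (i = ?p) :: real)"
    using child by (auto simp: succs_def)
  moreover have "(of_bool (i \<in> ancestors j) :: real) = of_bool (i = j) + of_bool (i \<in> ancestors ?p)"
    using j by (auto simp: ancestors_step[OF child.hyps])
  ultimately show ?case using child.IH by simp
qed

lemma height_succ: "c \<in> succs T r i \<Longrightarrow> height c = Suc (height i)"
  using parent_edge(2)[of c] by (auto simp: succs_def)

end

section \<open>Tree matrices and the identity Q U = -1\<close>

locale weighted_tree = rooted_tree +
  fixes w :: "nat \<Rightarrow> real"
  assumes weight: "level_weight T r w"
begin

lemma weight_pos: "0 < w (height i)"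
  using weight by (auto simp: level_weight_def depth_eq)

lemma incr_height_pos: "0 < incr w (height i)"
proof (cases "i = r")
  case True
  then show ?thesis using weight_pos[of r] by (simp add: incr_def)
next
  case False
  then have "w (height (parent T r i)) < w (height i)"
    using weight parent_edge(2)[OF False] rangeI[of height i]
    by (auto simp: level_weight_def depth_eq intro!: strict_mono_onD[of "range height" w])
  then show ?thesis using parent_edge(2)[OF False] by (simp add: incr_def)
qed

lemma tree_matrix_pos: "0 < tree_matrix T r w $ i $ j"
  by (simp add: tree_matrix_def depth_eq weight_pos)

text \<open>If \<open>i\<close> is an ancestor of \<open>j\<close>, the meets are \<open>i\<close>
  and its parent; otherwise both meets agree. Reading the missing parent of the root as 0 matches
  the convention for the weight at level -1, so the root fits the same formula.\<close>

lemma tree_matrix_diff: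
  "tree_matrix T r w $ i $ j - (if i = r then 0 else tree_matrix T r w $ parent T r i $ j) =
     incr w (height i) * of_bool (i \<in> ancestors j)"
proof (cases "i = r")
  case True
  then show ?thesis
    by (simp add: tree_matrix_def depth_eq meet_ancestor root_in_ancestors incr_def)
next
  case False
  show ?thesis
  proof (cases "i \<in> ancestors j")
    case True
    then have "parent T r i \<in> ancestors j"
      using ancestors_trans parent_in_ancestors[OF False] by blast
    then show ?thesis using True False parent_edge(2)[OF False]
      by (simp add: tree_matrix_def depth_eq meet_ancestor incr_def)
  next
    case ni: False
    then show ?thesis using False meet_parent[of i j] by (simp add: tree_matrix_def)
  qed
qed

text \<open>A vertex is neither its own parent nor its own grandparent, so the nested cases exclude
  each other and become a sum of indicators. The sum over an empty successor set absorbs the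
  separate case for leaves.\<close>

lemma tree_q_matrix_nth:
  "tree_q_matrix T r w $ i $ k =
    - of_bool (k = i) * (inverse (incr w (height i)) + (\<Sum>c\<in>succs T r i. inverse (incr w (height c))))
    + of_bool (i \<noteq> r \<and> k = parent T r i) * inverse (incr w (height i))
    + of_bool (k \<in> succs T r i) * inverse (incr w (height k))"
proof -
  have par: "parent T r x \<noteq> x" "parent T r x = r \<or> parent T r (parent T r x) \<noteq> x" if "x \<noteq> r" for x
  proof -
    have "height x = Suc (height (parent T r x))" using parent_edge(2)[OF that] .
    moreover have "height (parent T r x) = Suc (height (parent T r (parent T r x)))" if "parent T r x \<noteq> r"
      using parent_edge(2)[OF that] .
    ultimately show "parent T r x \<noteq> x" "parent T r x = r \<or> parent T r (parent T r x) \<noteq> x"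
      by (metis n_not_Suc_n, metis Suc_n_not_le_n le_SucI order_refl)
  qed
  have "(\<Sum>c\<in>succs T r i. inverse (incr w (height c))) =
      real (card (succs T r i)) * inverse (incr w (height i + 1))"
    by (simp add: height_succ)
  then show ?thesis using par
    by (auto simp: tree_q_matrix_def depth_eq succs_def)
qed

lemma tree_q_matrix_off_diagonal: "i \<noteq> k \<Longrightarrow> 0 \<le> tree_q_matrix T r w $ i $ k"
  using incr_height_pos by (auto simp: tree_q_matrix_nth less_imp_le)

lemma tree_q_matrix_mult_tree_matrix: "tree_q_matrix T r w ** tree_matrix T r w = - mat 1"
proof -
  let ?U = "tree_matrix T r w" and ?d = "\<lambda>i. inverse (incr w (height i))" and ?S = "succs T r"
  have "(tree_q_matrix T r w ** ?U) $ i $ j = - of_bool (i = j)" for i j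
  proof -
    have "(tree_q_matrix T r w ** ?U) $ i $ j =
       - (?d i + (\<Sum>c\<in>?S i. ?d c)) * ?U $ i $ j
       + of_bool (i \<noteq> r) * ?d i * ?U $ parent T r i $ j + (\<Sum>c\<in>?S i. ?d c * ?U $ c $ j)"
    proof -
      have 1: "(\<Sum>k\<in>UNIV. - of_bool (k = i) * (?d i + (\<Sum>c\<in>?S i. ?d c)) * ?U $ k $ j) =
          - (?d i + (\<Sum>c\<in>?S i. ?d c)) * ?U $ i $ j"
        by (simp add: of_bool_def if_distrib if_distribR cong: if_cong)
      have 2: "(\<Sum>k\<in>UNIV. of_bool (i \<noteq> r \<and> k = parent T r i) * ?d i * ?U $ k $ j) =
          of_bool (i \<noteq> r) * ?d i * ?U $ parent T r i $ j"
        by (simp add: of_bool_conj of_bool_def if_distrib if_distribR cong: if_cong)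
      have 3: "(\<Sum>k\<in>UNIV. of_bool (k \<in> ?S i) * ?d k * ?U $ k $ j) = (\<Sum>c\<in>?S i. ?d c * ?U $ c $ j)"
        by (simp add: of_bool_def if_distrib if_distribR sum.If_cases cong: if_cong)
      show ?thesis
        unfolding matrix_matrix_mult_def tree_q_matrix_nth
        by (simp only: vec_lambda_beta distrib_right[of _ _ "?U $ _ $ j"] sum.distrib 1 2 3)
    qed
    \<comment> \<open>Grouping by edges leaves only differences of \<open>?U\<close> between a
      vertex and its parent; each rate is the inverse of the increment in
      \<open>tree_matrix_diff\<close>, so only indicators survive.\<close>
    also have "\<dots> = - ?d i * (?U $ i $ j - (if i = r then 0 else ?U $ parent T r i $ j))
       + (\<Sum>c\<in>?S i. ?d c * (?U $ c $ j - ?U $ i $ j))"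
      by (simp add: algebra_simps sum_subtractf sum_distrib_left)
    also have "(\<Sum>c\<in>?S i. ?d c * (?U $ c $ j - ?U $ i $ j)) = (\<Sum>c\<in>?S i. of_bool (c \<in> ancestors j))"
    proof (rule sum.cong[OF refl])
      fix c assume "c \<in> ?S i"
      then have "?U $ c $ j - ?U $ i $ j = incr w (height c) * of_bool (c \<in> ancestors j)"
        using tree_matrix_diff[of c j] by (auto simp: succs_def)
      then show "?d c * (?U $ c $ j - ?U $ i $ j) = of_bool (c \<in> ancestors j)"
        using incr_height_pos[of c] by simp
    qed
    also have "- ?d i * (?U $ i $ j - (if i = r then 0 else ?U $ parent T r i $ j)) =
        - of_bool (i \<in> ancestors j)"
      unfolding tree_matrix_diff using incr_height_pos[of i] by simp
    finally show ?thesis using of_bool_ancestor[of i j] by simp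
  qed
  then show ?thesis by (simp add: vec_eq_iff mat_def)
qed

end

section \<open>Derivative and integral of the matrix exponential\<close>

definition mpow :: "real^'v^'v \<Rightarrow> nat \<Rightarrow> real^'v^'v" where
  "mpow A k = (((**) A) ^^ k) (mat 1)"

lemma mpow_0: "mpow A 0 = mat 1"
  and mpow_Suc: "mpow A (Suc k) = A ** mpow A k"
  by (simp_all add: mpow_def)

lemma mpow_Suc_right: "mpow A (Suc k) = mpow A k ** (A :: real^'v::finite^'v)"
  by (induction k) (simp_all add: mpow_0 mpow_Suc matrix_mul_assoc)

lemma mpow_scaleR: "mpow (t *\<^sub>R A) k = t ^ k *\<^sub>R mpow (A :: real^'v::finite^'v) k"
  by (induction k) (simp_all add: mpow_0 mpow_Suc matrix_scalar_ac scalar_matrix_assoc mult.commute flip: scalar_mult_eq_scaleR)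

text \<open>Every matrix product sums \<open>CARD('v)\<close> terms. The geometric bound lets the
  exponential series dominate each entry.\<close>

lemma abs_mpow_nth_le:
  fixes A :: "real^'v::finite^'v" and c :: real
  assumes "\<And>i j. \<bar>A $ i $ j\<bar> \<le> c"
  shows "\<bar>mpow A k $ i $ j\<bar> \<le> (CARD('v) * c) ^ k"
proof (induction k arbitrary: i)
  case 0
  then show ?case by (simp add: mpow_0 mat_def)
next
  case (Suc k)
  have "\<bar>mpow A (Suc k) $ i $ j\<bar> \<le> (\<Sum>l\<in>UNIV. \<bar>A $ i $ l * mpow A k $ l $ j\<bar>)"
    by (simp add: mpow_Suc matrix_matrix_mult_def)
  also have "\<dots> \<le> (\<Sum>l\<in>(UNIV :: 'v set). c * (CARD('v) * c) ^ k)"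
    using assms Suc order_trans[OF abs_ge_zero assms]
    by (intro sum_mono) (simp add: abs_mult mult_mono)
  finally show ?case by simp
qed

lemma summable_mpow_nth:
  fixes A :: "real^'v::finite^'v"
  shows "summable (\<lambda>k. mpow A k $ i $ j / fact k * t ^ k)"
proof -
  \<comment> \<open>The sum of all absolute values is a crude common bound for the entries.\<close>
  define c where "c = (\<Sum>i\<in>UNIV. \<Sum>j\<in>UNIV. \<bar>A $ i $ j\<bar>)"
  have "\<bar>A $ i $ j\<bar> \<le> c" for i j
  proof -
    have "\<bar>A $ i $ j\<bar> \<le> (\<Sum>j\<in>UNIV. \<bar>A $ i $ j\<bar>)"
      by (rule member_le_sum) auto
    also have "\<dots> \<le> c" unfolding c_def
      by (rule member_le_sum) (auto intro: sum_nonneg)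
    finally show ?thesis .
  qed
  note bound = abs_mpow_nth_le[of A, OF this]
  show ?thesis
  proof (rule summable_comparison_test')
    show "summable (\<lambda>k. inverse (fact k) * (CARD('v) * c * \<bar>t\<bar>) ^ k)"
      by (rule summable_exp)
    show "norm (mpow A k $ i $ j / fact k * t ^ k) \<le> inverse (fact k) * (CARD('v) * c * \<bar>t\<bar>) ^ k" for k
    proof -
      have "\<bar>mpow A k $ i $ j\<bar> * \<bar>t\<bar> ^ k \<le> (CARD('v) * c) ^ k * \<bar>t\<bar> ^ k"
        using bound by (rule mult_right_mono) simp
      then show ?thesis
        by (simp add: abs_mult power_abs divide_inverse power_mult_distrib mult_ac)
    qed
  qed
qed

text \<open>Convergence of matrices is entrywise, so each entry becomes a scalar power series in
  \<open>t\<close>, which can be differentiated term by term.\<close>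

lemma mexp_scaleR_nth:
  fixes A :: "real^'v::finite^'v"
  shows "mexp (t *\<^sub>R A) $ i $ j = (\<Sum>k. mpow A k $ i $ j / fact k * t ^ k)"
proof -
  have "(\<lambda>k. (1 / fact k) *\<^sub>R mpow (t *\<^sub>R A) k) sums (\<chi> i j. \<Sum>k. mpow A k $ i $ j / fact k * t ^ k)"
    unfolding sums_def
  proof (intro vec_tendstoI)
    fix i j
    have "(\<lambda>n. \<Sum>k<n. mpow A k $ i $ j / fact k * t ^ k) \<longlonglongrightarrow> (\<Sum>k. mpow A k $ i $ j / fact k * t ^ k)"
      using summable_mpow_nth summable_LIMSEQ by blast
    then show "(\<lambda>n. (\<Sum>k<n. (1 / fact k) *\<^sub>R mpow (t *\<^sub>R A) k) $ i $ j)
        \<longlonglongrightarrow> (\<chi> i j. \<Sum>k. mpow A k $ i $ j / fact k * t ^ k) $ i $ j"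
      by (simp add: mpow_scaleR mult_ac)
  qed
  then show ?thesis by (simp add: mexp_def mpow_def sums_iff)
qed

lemma mexp_0: "mexp (0 *\<^sub>R A :: real^'v::finite^'v) = mat 1"
  unfolding vec_eq_iff mexp_scaleR_nth powser_zero by (simp add: mpow_0)

text \<open>The derivative and the products with \<open>A\<close> on either side all have the same
  entrywise power series, because \<open>mpow A (Suc k)\<close> factors both ways.\<close>

lemma
  fixes A :: "real^'v::finite^'v"
  shows DERIV_mexp_left: "((\<lambda>t. mexp (t *\<^sub>R A) $ i $ j) has_real_derivative (A ** mexp (t *\<^sub>R A)) $ i $ j) (at t)"
    and mexp_commute: "(A ** mexp (t *\<^sub>R A)) = (mexp (t *\<^sub>R A) ** A)"
proof -
  \<comment> \<open>The factor \<open>Suc k\<close> from differentiation cancels against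
    \<open>fact (Suc k)\<close>.\<close>
  have D: "diffs (\<lambda>k. mpow A k $ i $ j / fact k) = (\<lambda>k. mpow A (Suc k) $ i $ j / fact k)" for i j
    by (simp add: diffs_def del: of_nat_Suc)
  have deriv: "((\<lambda>t. mexp (t *\<^sub>R A) $ i $ j) has_real_derivative
      (\<Sum>k. mpow A (Suc k) $ i $ j / fact k * t ^ k)) (at t)" for i j
    using termdiffs_strong_converges_everywhere[OF summable_mpow_nth, of A i j t]
    unfolding D mexp_scaleR_nth .
  have left: "(A ** mexp (t *\<^sub>R A)) $ i $ j = (\<Sum>k. mpow A (Suc k) $ i $ j / fact k * t ^ k)" for i j
  proof -
    have "(A ** mexp (t *\<^sub>R A)) $ i $ j = (\<Sum>l\<in>UNIV. \<Sum>k. A $ i $ l * (mpow A k $ l $ j / fact k * t ^ k))"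
      unfolding matrix_matrix_mult_def mexp_scaleR_nth vec_lambda_beta
      by (intro sum.cong refl suminf_mult[symmetric] summable_mpow_nth)
    also have "\<dots> = (\<Sum>k. \<Sum>l\<in>UNIV. A $ i $ l * (mpow A k $ l $ j / fact k * t ^ k))"
      by (rule suminf_sum[symmetric]) (intro summable_mult summable_mpow_nth)
    also have "(\<lambda>k. \<Sum>l\<in>UNIV. A $ i $ l * (mpow A k $ l $ j / fact k * t ^ k)) =
        (\<lambda>k. mpow A (Suc k) $ i $ j / fact k * t ^ k)"
      unfolding mpow_Suc matrix_matrix_mult_def vec_lambda_beta sum_divide_distrib sum_distrib_right by (simp add: mult.assoc)
    finally show ?thesis .
  qed
  have right: "(mexp (t *\<^sub>R A) ** A) $ i $ j = (\<Sum>k. mpow A (Suc k) $ i $ j / fact k * t ^ k)" for i j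
  proof -
    have "(mexp (t *\<^sub>R A) ** A) $ i $ j = (\<Sum>l\<in>UNIV. \<Sum>k. mpow A k $ i $ l / fact k * t ^ k * A $ l $ j)"
      unfolding matrix_matrix_mult_def mexp_scaleR_nth vec_lambda_beta
      by (intro sum.cong refl suminf_mult2 summable_mpow_nth)
    also have "\<dots> = (\<Sum>k. \<Sum>l\<in>UNIV. mpow A k $ i $ l / fact k * t ^ k * A $ l $ j)"
      by (rule suminf_sum[symmetric]) (intro summable_mult2 summable_mpow_nth)
    also have "(\<lambda>k. \<Sum>l\<in>UNIV. mpow A k $ i $ l / fact k * t ^ k * A $ l $ j) =
        (\<lambda>k. mpow A (Suc k) $ i $ j / fact k * t ^ k)"
      unfolding mpow_Suc_right matrix_matrix_mult_def vec_lambda_beta sum_divide_distrib sum_distrib_right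
      by (simp add: mult_ac)
    finally show ?thesis .
  qed
  show "((\<lambda>t. mexp (t *\<^sub>R A) $ i $ j) has_real_derivative (A ** mexp (t *\<^sub>R A)) $ i $ j) (at t)"
    unfolding left by (rule deriv)
  show "(A ** mexp (t *\<^sub>R A)) = (mexp (t *\<^sub>R A) ** A)"
    unfolding vec_eq_iff left right by blast
qed

lemma DERIV_mexp_right:
  fixes A :: "real^'v::finite^'v"
  shows "((\<lambda>t. mexp (t *\<^sub>R A) $ i $ j) has_real_derivative (mexp (t *\<^sub>R A) ** A) $ i $ j) (at t)"
  using DERIV_mexp_left[of A i j t] by (simp only: mexp_commute)

lemma continuous_mexp:
  fixes A :: "real^'v::finite^'v"
  shows "continuous_on S (\<lambda>t. mexp (t *\<^sub>R A) $ i $ j)"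
  by (intro continuous_at_imp_continuous_on ballI DERIV_isCont[OF DERIV_mexp_left])

section \<open>Uniqueness for linear differential equations\<close>

lemma DERIV_matrix_mult:
  fixes F :: "real \<Rightarrow> real^'m::finite^'l" and G :: "real \<Rightarrow> real^'n^'m"
  assumes "\<And>k. ((\<lambda>t. F t $ i $ k) has_real_derivative F' $ i $ k) (at t)"
    and "\<And>k. ((\<lambda>t. G t $ k $ j) has_real_derivative G' $ k $ j) (at t)"
  shows "((\<lambda>t. (F t ** G t) $ i $ j) has_real_derivative (F' ** G t) $ i $ j + (F t ** G') $ i $ j) (at t)"
proof -
  have "((\<lambda>t. \<Sum>k\<in>UNIV. F t $ i $ k * G t $ k $ j) has_real_derivative
      (\<Sum>k\<in>UNIV. F' $ i $ k * G t $ k $ j + F t $ i $ k * G' $ k $ j)) (at t)"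
    by (auto intro!: derivative_eq_intros assms intro: sum.cong)
  then show ?thesis by (simp add: matrix_matrix_mult_def sum.distrib)
qed

text \<open>The product rule gives the derivative F A e^(-tA) - F A e^(-tA) = 0. An arbitrary
  \<open>F\<close> serves both inversion and uniqueness; only interior derivatives are assumed
  because the transition function is shown to be differentiable at positive times only.\<close>

lemma matrix_mult_mexp_minus_const:
  fixes A :: "real^'v::finite^'v"
  assumes "a \<le> b"
    and cont: "\<And>i j. continuous_on {a..b} (\<lambda>t. F t $ i $ j)"
    and deriv: "\<And>t i j. a < t \<Longrightarrow> t < b \<Longrightarrow>
      ((\<lambda>t. F t $ i $ j) has_real_derivative (F t ** A) $ i $ j) (at t)"
  shows "F b ** mexp ((- b) *\<^sub>R A) = F a ** mexp ((- a) *\<^sub>R A)"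
proof (cases "a = b")
  case True
  then show ?thesis by (simp only:)
next
  case False
  with \<open>a \<le> b\<close> have "a < b" by simp
  show ?thesis unfolding vec_eq_iff
  proof (intro allI)
    fix i j
    let ?E = "\<lambda>t. mexp ((- t) *\<^sub>R A)"
    have E: "((\<lambda>t. ?E t $ k $ j) has_real_derivative - (A ** ?E t) $ k $ j) (at t)" for k t
      using DERIV_chain2[where f = "\<lambda>t. mexp (t *\<^sub>R A) $ k $ j" and g = uminus and x = t and Db = "- 1",
          OF DERIV_mexp_left]
      by (simp add: DERIV_minus[OF DERIV_ident])
    have "((\<lambda>t. (F t ** ?E t) $ i $ j) has_real_derivative 0) (at t)" if "a < t" "t < b" for t
    proof -
      have "((\<lambda>t. (F t ** ?E t) $ i $ j) has_real_derivative
          ((F t ** A) ** ?E t) $ i $ j + (F t ** (- (A ** ?E t))) $ i $ j) (at t)"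
        using E by (intro DERIV_matrix_mult deriv[OF that]) simp
      moreover have "(F t ** (- (A ** ?E t))) $ i $ j = - (F t ** (A ** ?E t)) $ i $ j"
        by (simp add: matrix_matrix_mult_def[of "F t"] sum_negf)
      ultimately show ?thesis by (simp add: matrix_mul_assoc)
    qed
    moreover have "continuous_on {a..b} (\<lambda>t. (F t ** ?E t) $ i $ j)"
      unfolding matrix_matrix_mult_def vec_lambda_beta
      by (intro continuous_intros cont continuous_at_imp_continuous_on ballI DERIV_isCont[OF E])
    ultimately show "(F b ** ?E b) $ i $ j = (F a ** ?E a) $ i $ j"
      using DERIV_isconst_end[OF \<open>a < b\<close>] by blast
  qed
qed

text \<open>The exponential itself is taken for \<open>F\<close>, and the constant value is read off
  at 0. For negative \<open>t\<close> the end points change roles.\<close>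

lemma mexp_minus:
  fixes A :: "real^'v::finite^'v"
  shows "mexp (t *\<^sub>R A) ** mexp ((- t) *\<^sub>R A) = mat 1"
proof -
  have "mexp (b *\<^sub>R A) ** mexp ((- b) *\<^sub>R A) = mexp (a *\<^sub>R A) ** mexp ((- a) *\<^sub>R A)" if "a \<le> b" for a b
    by (rule matrix_mult_mexp_minus_const[where F = "\<lambda>t. mexp (t *\<^sub>R A)", OF that continuous_mexp DERIV_mexp_right])
  then have "mexp (t *\<^sub>R A) ** mexp ((- t) *\<^sub>R A) = mexp (0 *\<^sub>R A) ** mexp ((- 0) *\<^sub>R A)"
    by (cases "0 \<le> t") (blast, metis linear)
  then show ?thesis by (simp only: minus_zero mexp_0 matrix_mul_lid)
qed

text \<open>\<open>F t\<close> times the exponential at \<open>- t\<close> keeps its initial value,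
  the identity; multiplying by the inverse of that exponential isolates \<open>F t\<close>.\<close>

lemma linear_ode_unique:
  fixes A :: "real^'v::finite^'v"
  assumes "F 0 = mat 1" "0 \<le> t"
    and cont: "\<And>i j. continuous_on {0..t} (\<lambda>t. F t $ i $ j)"
    and deriv: "\<And>s i j. 0 < s \<Longrightarrow> s < t \<Longrightarrow>
      ((\<lambda>t. F t $ i $ j) has_real_derivative (F s ** A) $ i $ j) (at s)"
  shows "F t = mexp (t *\<^sub>R A)"
proof -
  have "F t ** mexp ((- t) *\<^sub>R A) = F 0 ** mexp ((- 0) *\<^sub>R A)"
    by (rule matrix_mult_mexp_minus_const[OF \<open>0 \<le> t\<close> cont deriv])
  also have "\<dots> = mat 1" using assms(1) by (simp add: mexp_0[of A, simplified])
  finally have "F t ** (mexp ((- t) *\<^sub>R A) ** mexp ((- (- t)) *\<^sub>R A)) = mexp ((- (- t)) *\<^sub>R A)"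
    by (simp only: matrix_mul_assoc matrix_mul_lid)
  then show ?thesis unfolding mexp_minus by simp
qed

section \<open>Nonnegativity, decay and integration\<close>

lemma mpow_nonneg:
  assumes "\<And>i j. 0 \<le> A $ i $ j"
  shows "0 \<le> mpow (A :: real^'v::finite^'v) k $ i $ j"
  using assms by (induction k arbitrary: i)
    (auto simp: mpow_0 mat_def mpow_Suc matrix_matrix_mult_def intro!: sum_nonneg)

lemma matrix_mult_nth_scale:
  "((\<chi> i j. c * F $ i $ j) ** A) $ i $ j = c * (F ** A) $ i $ (j :: 'v::finite)"
  for c :: real
  by (simp add: matrix_matrix_mult_def sum_distrib_left mult_ac)

text \<open>Adding a multiple of the identity makes all entries of \<open>A\<close> nonnegative and only
  rescales the exponential.\<close>

lemma mexp_nonneg: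
  fixes A :: "real^'v::finite^'v"
  assumes off: "\<And>i j. i \<noteq> j \<Longrightarrow> 0 \<le> A $ i $ j" and "0 \<le> t"
  shows "0 \<le> mexp (t *\<^sub>R A) $ i $ j"
proof -
  \<comment> \<open>This dominates the absolute value of every diagonal entry, so adding it on the
    diagonal makes all entries nonnegative.\<close>
  define c where "c = (\<Sum>i\<in>UNIV. \<bar>A $ i $ i\<bar>)"
  have c: "\<bar>A $ i $ i\<bar> \<le> c" for i unfolding c_def by (rule member_le_sum) auto
  define B where "B = A + mat c"
  have B: "0 \<le> B $ i $ j" for i j
    using off[of i j] c[of i] by (auto simp: B_def mat_def)
  \<comment> \<open>The derivative of the scalar factor removes the shift \<open>c\<close>, so
    \<open>F\<close> solves the equation of \<open>A\<close> and uniqueness identifies it with the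
    exponential of \<open>A\<close>.\<close>
  define F where "F t = (\<chi> i j. exp (- c * t) * mexp (t *\<^sub>R B) $ i $ j)" for t
  have "F t = mexp (t *\<^sub>R A)"
  proof (rule linear_ode_unique[where F = F])
    show "F 0 = mat 1" by (simp add: F_def mexp_0[of B, simplified])
    show "continuous_on {0..t} (\<lambda>t. F t $ i $ j)" for i j
      by (auto simp: F_def intro!: continuous_intros continuous_mexp)
    show "((\<lambda>t. F t $ i $ j) has_real_derivative (F s ** A) $ i $ j) (at s)" for s i j
    proof -
      have "((\<lambda>t. F t $ i $ j) has_real_derivative
         exp (- c * s) * (mexp (s *\<^sub>R B) ** B) $ i $ j - c * (exp (- c * s) * mexp (s *\<^sub>R B) $ i $ j)) (at s)"
        unfolding F_def vec_lambda_beta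
        by (auto intro!: derivative_eq_intros DERIV_mexp_right)
      moreover have "(M ** B) $ i $ j = (M ** A) $ i $ j + c * M $ i $ j" for M :: "real^'v^'v"
      proof -
        have "(\<Sum>k\<in>UNIV. M $ i $ k * (if k = j then c else 0)) = c * M $ i $ j"
          by (simp add: if_distrib cong: if_cong)
        then show ?thesis
          by (simp add: B_def matrix_matrix_mult_def mat_def distrib_left sum.distrib)
      qed
      ultimately show ?thesis
        by (simp add: F_def matrix_mult_nth_scale algebra_simps)
    qed
  qed (use \<open>0 \<le> t\<close> in auto)
  moreover have "0 \<le> mexp (t *\<^sub>R B) $ i $ j"
    unfolding mexp_scaleR_nth using B \<open>0 \<le> t\<close>
    by (intro suminf_nonneg summable_mpow_nth) (auto intro!: mult_nonneg_nonneg divide_nonneg_nonneg mpow_nonneg)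
  ultimately show ?thesis by (simp add: F_def flip: \<open>F t = mexp (t *\<^sub>R A)\<close>)
qed

text \<open>The vector \<open>h = U 1\<close> satisfies \<open>A h = - 1 \<le> - \<epsilon> h\<close>, which makes
  \<open>e\<^sup>t\<^sup>A h\<close> decay exponentially.\<close>

lemma mexp_tendsto_0:
  fixes A U :: "real^'v::finite^'v"
  assumes off: "\<And>i j. i \<noteq> j \<Longrightarrow> 0 \<le> A $ i $ j"
    and U: "\<And>i j. 0 < U $ i $ j" and inv: "A ** U = - mat 1"
  shows "((\<lambda>t. mexp (t *\<^sub>R A) $ i $ j) \<longlongrightarrow> 0) at_top"
proof -
  define h where "h j = (\<Sum>k\<in>UNIV. U $ j $ k)" for j
  have h: "0 < h j" for j unfolding h_def using U by (intro sum_pos) auto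
  \<comment> \<open>Each \<open>h j\<close> is at most the sum of all of them, hence \<epsilon>
    times \<open>h j\<close> is at most 1.\<close>
  define \<epsilon> where "\<epsilon> = 1 / (\<Sum>j\<in>UNIV. h j)"
  have hle: "h j \<le> (\<Sum>j\<in>UNIV. h j)" for j using h by (intro member_le_sum) (auto simp: less_imp_le)
  have S: "0 < (\<Sum>j\<in>UNIV. h j)" using h by (intro sum_pos) auto
  have \<epsilon>: "0 < \<epsilon>" "\<epsilon> * h j \<le> 1" for j using S hle[of j] by (auto simp: \<epsilon>_def)
  have Ah: "(\<Sum>j\<in>UNIV. A $ l $ j * h j) = - 1" for l
  proof -
    have "(\<Sum>j\<in>UNIV. A $ l $ j * h j) = (\<Sum>k\<in>UNIV. (A ** U) $ l $ k)"
      unfolding h_def matrix_matrix_mult_def vec_lambda_beta sum_distrib_left by (rule sum.swap)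
    then show ?thesis by (simp add: inv mat_def sum_negf)
  qed
  let ?E = "\<lambda>t. mexp (t *\<^sub>R A)"
  \<comment> \<open>By \<open>Ah\<close> the derivative is a sum of nonnegative entries times the
    nonpositive factors \<epsilon> \<open>h l\<close> - 1, so \<open>g\<close> decreases.\<close>
  define g where "g t = exp (\<epsilon> * t) * (\<Sum>l\<in>UNIV. ?E t $ i $ l * h l)" for t
  have g: "(g has_real_derivative exp (\<epsilon> * t) * (\<Sum>l\<in>UNIV. ?E t $ i $ l * (\<epsilon> * h l - 1))) (at t)" for t
  proof -
    have "(g has_real_derivative exp (\<epsilon> * t) * \<epsilon> * (\<Sum>l\<in>UNIV. ?E t $ i $ l * h l)
       + exp (\<epsilon> * t) * (\<Sum>l\<in>UNIV. (?E t ** A) $ i $ l * h l)) (at t)"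
      unfolding g_def by (auto intro!: derivative_eq_intros DERIV_mexp_right)
    moreover have "(\<Sum>l\<in>UNIV. (?E t ** A) $ i $ l * h l) = (\<Sum>l\<in>UNIV. ?E t $ i $ l * (\<Sum>j\<in>UNIV. A $ l $ j * h j))"
      unfolding matrix_matrix_mult_def vec_lambda_beta sum_distrib_left sum_distrib_right mult.assoc
      by (rule sum.swap)
    moreover have "(\<Sum>l\<in>UNIV. ?E t $ i $ l * (\<epsilon> * h l - 1)) =
        \<epsilon> * (\<Sum>l\<in>UNIV. ?E t $ i $ l * h l) + (\<Sum>l\<in>UNIV. ?E t $ i $ l * - 1)"
      unfolding right_diff_distrib sum_subtractf sum_distrib_left by (simp add: mult_ac sum_negf)
    ultimately show ?thesis unfolding Ah by (simp add: distrib_left mult.assoc)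
  qed
  have "g t \<le> g 0" if "0 \<le> t" for t
  proof (rule DERIV_nonpos_imp_nonincreasing[OF that])
    fix x :: real assume "0 \<le> x" "x \<le> t"
    then have "exp (\<epsilon> * x) * (\<Sum>l\<in>UNIV. ?E x $ i $ l * (\<epsilon> * h l - 1)) \<le> 0"
      using \<epsilon> mexp_nonneg[OF off]
      by (intro mult_nonneg_nonpos sum_nonpos) auto
    then show "\<exists>y. (g has_real_derivative y) (at x) \<and> y \<le> 0" using g by blast
  qed
  \<comment> \<open>All summands of \<open>g\<close> are nonnegative, so the one for
    \<open>j\<close> is bounded by \<open>g t\<close>; dividing by the positive \<open>h j\<close>
    gives the rate.\<close>
  then have bound: "?E t $ i $ j \<le> g 0 / h j * exp (- \<epsilon> * t)" if "0 \<le> t" for t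
  proof -
    have "exp (\<epsilon> * t) * (?E t $ i $ j * h j) \<le> g t"
      unfolding g_def using that h mexp_nonneg[OF off]
      by (intro mult_left_mono member_le_sum) (auto simp: less_imp_le)
    also have "\<dots> \<le> g 0" using \<open>\<And>t. 0 \<le> t \<Longrightarrow> g t \<le> g 0\<close> that .
    finally show ?thesis using h[of j] by (simp add: exp_minus field_simps)
  qed
  have "((\<lambda>t. g 0 / h j * exp (- \<epsilon> * t)) \<longlongrightarrow> g 0 / h j * 0) at_top"
    using \<epsilon>(1) by (intro tendsto_intros filterlim_compose[OF exp_at_bot]
        filterlim_tendsto_neg_mult_at_bot[OF tendsto_const _ filterlim_ident]) auto
  then have lim: "((\<lambda>t. g 0 / h j * exp (- \<epsilon> * t)) \<longlongrightarrow> 0) at_top" by simp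
  show ?thesis
  proof (rule tendsto_sandwich[OF _ _ tendsto_const lim])
    show "\<forall>\<^sub>F t in at_top. 0 \<le> ?E t $ i $ j"
      using eventually_ge_at_top[of 0] by eventually_elim (rule mexp_nonneg[OF off])
    show "\<forall>\<^sub>F t in at_top. ?E t $ i $ j \<le> g 0 / h j * exp (- \<epsilon> * t)"
      using eventually_ge_at_top[of 0] by eventually_elim (rule bound)
  qed
qed

text \<open>The primitive -e^(tA) U rises from -U at 0 to its limit 0. Since the integrand is
  nonnegative, this one computation yields both integrability and the value.\<close>

lemma nn_integral_mexp:
  fixes A U :: "real^'v::finite^'v"
  assumes off: "\<And>i j. i \<noteq> j \<Longrightarrow> 0 \<le> A $ i $ j"
    and U: "\<And>i j. 0 < U $ i $ j" and inv: "A ** U = - mat 1"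
  shows "(\<integral>\<^sup>+t. ennreal (mexp (t *\<^sub>R A) $ i $ j) * indicator {0..} t \<partial>lborel) = ennreal (U $ i $ j)"
proof -
  let ?E = "\<lambda>t. mexp (t *\<^sub>R A)"
  have "(\<integral>\<^sup>+t. ennreal (?E t $ i $ j) * indicator {0..} t \<partial>lborel) = 0 - (- (?E 0 ** U) $ i $ j)"
  proof (rule nn_integral_FTC_atLeast)
    show "(\<lambda>t. ?E t $ i $ j) \<in> borel_measurable borel"
      by (rule borel_measurable_continuous_onI[OF continuous_mexp])
    show "0 \<le> ?E t $ i $ j" if "0 \<le> t" for t using mexp_nonneg[OF off that] .
    show "((\<lambda>t. - (?E t ** U) $ i $ j) has_real_derivative ?E t $ i $ j) (at t)" for t
    proof -
      have "((\<lambda>t. - (?E t ** U) $ i $ j) has_real_derivative - ((?E t ** A) ** U) $ i $ j) (at t)"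
        using DERIV_matrix_mult[where F = ?E and G = "\<lambda>_. U" and G' = 0, OF DERIV_mexp_right]
        by (intro DERIV_minus) (simp add: matrix_matrix_mult_def)
      moreover have "(?E t ** A) ** U = - ?E t"
        unfolding matrix_mul_assoc[symmetric] inv
        by (simp add: vec_eq_iff matrix_matrix_mult_def mat_def if_distrib cong: if_cong)
      ultimately show ?thesis by simp
    qed
    have "((\<lambda>t. - (\<Sum>k\<in>UNIV. ?E t $ i $ k * U $ k $ j)) \<longlongrightarrow> - (\<Sum>k\<in>UNIV. 0 * U $ k $ j)) at_top"
      by (intro tendsto_intros mexp_tendsto_0[OF assms])
    then show "((\<lambda>t. - (?E t ** U) $ i $ j) \<longlongrightarrow> 0) at_top"
      by (simp add: matrix_matrix_mult_def)
  qed
  then show ?thesis by (simp add: mexp_0[of A, simplified])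
qed

text \<open>Expansion in matrix units writes a matrix function as a finite sum of scalar functions
  times constant matrices.\<close>

lemma has_bochner_integral_matrix:
  fixes F :: "'a \<Rightarrow> real^'n::finite^'m::finite"
  assumes "\<And>i j. has_bochner_integral M (\<lambda>x. F x $ i $ j) (U $ i $ j)"
  shows "has_bochner_integral M F U"
proof -
  have expand: "V = (\<Sum>i\<in>UNIV. \<Sum>j\<in>UNIV. V $ i $ j *\<^sub>R axis i (axis j (1::real)))" for V :: "real^'n^'m"
  proof -
    have "(\<Sum>j\<in>UNIV. (V $ i $ j *\<^sub>R axis i (axis j (1::real))) $ a $ b) = (if i = a then V $ a $ b else 0)" for i a b
    proof (cases "i = a")
      case True
      have "(V $ i $ j *\<^sub>R axis i (axis j (1::real))) $ a $ b = (if b = j then V $ a $ j else 0)" for j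
        using True by (simp add: axis_def)
      then show ?thesis using True by simp
    qed (simp add: axis_def)
    then show ?thesis by (simp add: vec_eq_iff)
  qed
  have F: "F = (\<lambda>x. \<Sum>i\<in>UNIV. \<Sum>j\<in>UNIV. F x $ i $ j *\<^sub>R axis i (axis j (1::real)))"
    by (rule ext) (rule expand)
  have "has_bochner_integral M (\<lambda>x. \<Sum>i\<in>UNIV. \<Sum>j\<in>UNIV. F x $ i $ j *\<^sub>R axis i (axis j (1::real)))
      (\<Sum>i\<in>UNIV. \<Sum>j\<in>UNIV. U $ i $ j *\<^sub>R axis i (axis j (1::real)))"
    by (intro has_bochner_integral_sum has_bochner_integral_scaleR_left assms)
  then show ?thesis by (simp only: F[symmetric] expand[of U, symmetric])
qed

lemma has_bochner_integral_mexp: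
  fixes A U :: "real^'v::finite^'v"
  assumes off: "\<And>i j. i \<noteq> j \<Longrightarrow> 0 \<le> A $ i $ j"
    and U: "\<And>i j. 0 < U $ i $ j" and inv: "A ** U = - mat 1"
  shows "has_bochner_integral lborel (\<lambda>t. indicator {0..} t *\<^sub>R mexp (t *\<^sub>R A)) U"
proof (rule has_bochner_integral_matrix)
  fix i j
  show "has_bochner_integral lborel (\<lambda>t. (indicator {0..} t *\<^sub>R mexp (t *\<^sub>R A)) $ i $ j) (U $ i $ j)"
  proof (rule has_bochner_integral_nn_integral)
    have [measurable]: "(\<lambda>t. mexp (t *\<^sub>R A) $ i $ j) \<in> borel_measurable borel"
      by (rule borel_measurable_continuous_onI[OF continuous_mexp])
    show "(\<lambda>t. (indicator {0..} t *\<^sub>R mexp (t *\<^sub>R A)) $ i $ j) \<in> borel_measurable lborel"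
      by simp
    show "AE t in lborel. 0 \<le> (indicator {0..} t *\<^sub>R mexp (t *\<^sub>R A)) $ i $ j"
      using mexp_nonneg[OF off] by (auto simp: indicator_def)
    have "(\<integral>\<^sup>+t. ennreal ((indicator {0..} t *\<^sub>R mexp (t *\<^sub>R A)) $ i $ j) \<partial>lborel) =
        (\<integral>\<^sup>+t. ennreal (mexp (t *\<^sub>R A) $ i $ j) * indicator {0..} t \<partial>lborel)"
      by (intro nn_integral_cong) (auto simp: indicator_def)
    then show "(\<integral>\<^sup>+t. ennreal ((indicator {0..} t *\<^sub>R mexp (t *\<^sub>R A)) $ i $ j) \<partial>lborel) = ennreal (U $ i $ j)"
      using nn_integral_mexp[OF assms] by simp
  qed (use U in \<open>simp add: less_imp_le\<close>)
qed

section \<open>Transition function and occupation times\<close>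

text \<open>Adding 1 to the floor keeps the grid point strictly after \<open>t\<close> even when
  \<open>t\<close> is on the grid, as the filter \<open>at_right t\<close> requires.\<close>

lemma tendsto_grid_from_right:
  "filterlim (\<lambda>n. (of_int \<lfloor>real (Suc n) * t\<rfloor> + 1) / real (Suc n)) (at_right t) sequentially"
proof -
  let ?s = "\<lambda>n. (of_int \<lfloor>real (Suc n) * t\<rfloor> + 1) / real (Suc n)"
  have gt: "t < ?s n" for n
  proof -
    have "real (Suc n) * t < of_int \<lfloor>real (Suc n) * t\<rfloor> + 1" by linarith
    then show ?thesis by (simp add: pos_less_divide_eq mult.commute del: of_nat_Suc)
  qed
  have le: "?s n \<le> t + 1 / real (Suc n)" for n
  proof -
    have "of_int \<lfloor>real (Suc n) * t\<rfloor> + 1 \<le> real (Suc n) * t + 1" by linarith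
    then have "?s n \<le> (real (Suc n) * t + 1) / real (Suc n)" by (rule divide_right_mono) simp
    then show ?thesis by (simp add: add_divide_distrib del: of_nat_Suc)
  qed
  have "(\<lambda>n. t + 1 / real (Suc n)) \<longlonglongrightarrow> t + 0"
    by (intro tendsto_add tendsto_const LIMSEQ_Suc[OF lim_1_over_n])
  then have "?s \<longlonglongrightarrow> t"
    using gt le by (intro tendsto_sandwich[OF _ _ tendsto_const, of t ?s _ "\<lambda>n. t + 1 / real (Suc n)"])
      (auto intro!: always_eventually less_imp_le simp del: of_nat_Suc)
  then show ?thesis unfolding filterlim_at
    by (intro conjI always_eventually allI) (simp_all add: gt gt[THEN less_imp_neq, symmetric] del: of_nat_Suc)
qed

section \<open>From the Markov property to the exponential\<close>

context ctmc
begin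

definition transition :: "real \<Rightarrow> real^'v^'v" where
  "transition t = (\<chi> i j. measure (P i) {\<omega> \<in> space (P i). X t \<omega> = Some j})"

lemma finite_measure: "finite_measure (P i)"
  by (rule prob_space.axioms(1)[OF prob])

lemma sets_event: "0 \<le> t \<Longrightarrow> {\<omega> \<in> space (P i). X t \<omega> = Some j} \<in> sets (P i)"
  using measurable_sets[OF random_variable, of t "{Some j}" i] by (simp add: vimage_def Int_def conj_commute)

lemma transition_nonneg: "0 \<le> transition t $ i $ j"
  by (simp add: transition_def)

lemma transition_le_1: "transition t $ i $ j \<le> 1"
  by (simp add: transition_def prob_space.prob_le_1[OF prob])

lemma transition_0: "transition 0 = mat 1"
proof -
  have "measure (P i) {\<omega> \<in> space (P i). X 0 \<omega> = Some j} = of_bool (i = j)" for i j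
  proof (cases "i = j")
    case True
    then show ?thesis
      using start[of i] prob_space.prob_eq_1[OF prob sets_event[of 0 i j]] by (auto elim: AE_mp)
  next
    case False
    have "AE \<omega> in P i. \<omega> \<notin> {\<omega> \<in> space (P i). X 0 \<omega> = Some j}"
      using start[of i] by eventually_elim (use False in auto)
    then show ?thesis
      using False prob_space.prob_eq_0[OF prob sets_event[of 0 i j]] by auto
  qed
  then show ?thesis by (simp add: transition_def mat_def vec_eq_iff)
qed

lemma chapman_kolmogorov:
  assumes "0 \<le> s" "0 \<le> t"
  shows "transition (s + t) = transition s ** transition t"
proof -
  have "measure (P i) {\<omega> \<in> space (P i). X (s + t) \<omega> = Some j} =
      (\<Sum>k\<in>UNIV. transition s $ i $ k * transition t $ k $ j)" for i j
  proof -
    let ?A = "\<lambda>k. {\<omega> \<in> space (P i). X s \<omega> = Some k \<and> X (s + t) \<omega> = Some j}"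
    \<comment> \<open>The cemetery is absorbing: by \<open>lifetime\<close>, a path that is dead at
      \<open>s\<close> is dead at \<open>s + t\<close>. Hence summing over states at time
      \<open>s\<close> loses nothing.\<close>
    have "X s \<omega> \<noteq> None" if "\<omega> \<in> space (P i)" "X (s + t) \<omega> \<noteq> None" for \<omega>
      using that lifetime[of s \<omega> i] lifetime[of "s + t" \<omega> i] assms
      by (meson add_nonneg_nonneg ennreal_leI le_add_same_cancel1 order_trans)
    then have "{\<omega> \<in> space (P i). X (s + t) \<omega> = Some j} = (\<Union>k. ?A k)" by fastforce
    moreover have "?A k \<in> sets (P i)" for k
      using sets.Int[OF sets_event[of s i k] sets_event[of "s + t" i j]] assms
      by (simp add: Int_def conj_ac cong: conj_cong)
    then have "measure (P i) (\<Union>k. ?A k) = (\<Sum>k\<in>UNIV. measure (P i) (?A k))"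
      by (intro finite_measure.finite_measure_finite_Union[OF finite_measure])
        (auto simp: disjoint_family_on_def)
    moreover have "space (P i) \<in> past (space (P i)) X s"
      unfolding past_def by (rule sigma_sets_top)
    then have "measure (P i) (?A k) = transition s $ i $ k * transition t $ k $ j" for k
      unfolding transition_def vec_lambda_beta by (rule markov[OF assms])
    ultimately show ?thesis by simp
  qed
  then show ?thesis by (simp add: transition_def[of "s + t"] matrix_matrix_mult_def vec_eq_iff)
qed

lemma transition_generator:
  "((\<lambda>h. (transition h - mat 1) $ i $ j / h) \<longlongrightarrow> Q $ i $ j) (at_right 0)"
  using generator by (simp add: transition_def mat_def)

text \<open>The difference quotient converges, and multiplying it by \<open>h\<close> sends it to 0;
  this is right continuity of the transition function at 0.\<close>

lemma transition_tendsto_0: "((\<lambda>h. (transition h - mat 1) $ i $ j) \<longlongrightarrow> 0) (at_right 0)"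
proof -
  have "((\<lambda>h. (transition h - mat 1) $ i $ j / h * h) \<longlongrightarrow> Q $ i $ j * 0) (at_right 0)"
    by (intro tendsto_mult transition_generator) (simp add: tendsto_ident_at)
  moreover have "\<forall>\<^sub>F h in at_right 0. (transition h - mat 1) $ i $ j / h * h = (transition h - mat 1) $ i $ j"
    using eventually_at_right_less by eventually_elim simp
  ultimately show ?thesis by (simp add: tendsto_cong)
qed

text \<open>Increments at any time reduce to those at 0. The short time stands in the right factor,
  which is what yields p' = p Q.\<close>

lemma transition_diff:
  assumes "0 \<le> s" "0 \<le> t"
  shows "(transition (s + t) - transition s) $ i $ j =
    (\<Sum>k\<in>UNIV. transition s $ i $ k * (transition t - mat 1) $ k $ j)"
proof -
  have "transition (s + t) - transition s = transition s ** (transition t - mat 1)"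
    using matrix_add_ldistrib[of "transition s" "transition t - mat 1" "mat 1"]
    by (simp add: chapman_kolmogorov[OF assms])
  then show ?thesis by (simp add: matrix_matrix_mult_def)
qed

text \<open>On the left of \<open>t\<close> one writes \<open>p\<^sub>t = p\<^sub>t\<^sub>-\<^sub>h p\<^sub>h\<close>, so left continuity of the bounded
  function \<open>p\<close> comes first.\<close>

lemma DERIV_transition:
  assumes "0 < t"
  shows "((\<lambda>t. transition t $ i $ j) has_real_derivative (transition t ** Q) $ i $ j) (at t)"
proof -
  let ?p = transition and ?q = "\<lambda>h. transition h - mat 1"
  have small: "\<forall>\<^sub>F h in at_right 0. h \<in> {0<..<t}"
    using eventually_at_right_real[OF assms] .
  have left_cont: "((\<lambda>h. ?p (t - h) $ i $ k) \<longlongrightarrow> ?p t $ i $ k) (at_right 0)" for k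
  proof -
    \<comment> \<open>The entries of \<open>?p (t - h)\<close> lie between 0 and 1, so the increment
      over \<open>h\<close> is bounded by this sum, whatever the moving factor is.\<close>
    have "((\<lambda>h. \<Sum>l\<in>UNIV. \<bar>?q h $ l $ k\<bar>) \<longlongrightarrow> (\<Sum>l\<in>(UNIV :: 'v set). \<bar>0\<bar>)) (at_right 0)"
      by (intro tendsto_intros transition_tendsto_0)
    then have lim: "((\<lambda>h. \<Sum>l\<in>UNIV. \<bar>?q h $ l $ k\<bar>) \<longlongrightarrow> 0) (at_right 0)" by simp
    have "((\<lambda>h. ?p (t - h) $ i $ k - ?p t $ i $ k) \<longlongrightarrow> 0) (at_right 0)"
    proof (rule Lim_null_comparison[OF _ lim])
      show "\<forall>\<^sub>F h in at_right 0. norm (?p (t - h) $ i $ k - ?p t $ i $ k) \<le> (\<Sum>l\<in>UNIV. \<bar>?q h $ l $ k\<bar>)"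
        using small
      proof eventually_elim
        case (elim h)
        have "norm (?p (t - h) $ i $ k - ?p t $ i $ k) = \<bar>(?p (t - h + h) - ?p (t - h)) $ i $ k\<bar>"
          by (simp add: abs_minus_commute)
        also have "\<dots> = \<bar>\<Sum>l\<in>UNIV. ?p (t - h) $ i $ l * ?q h $ l $ k\<bar>"
          using elim transition_diff[of "t - h" h i k] by simp
        also have "\<dots> \<le> (\<Sum>l\<in>UNIV. \<bar>?p (t - h) $ i $ l * ?q h $ l $ k\<bar>)" by (rule sum_abs)
        also have "\<dots> \<le> (\<Sum>l\<in>UNIV. \<bar>?q h $ l $ k\<bar>)"
          using transition_nonneg transition_le_1
          by (intro sum_mono) (simp add: abs_mult mult_left_le_one_le)
        finally show ?case .
      qed
    qed
    then show ?thesis by (simp add: LIM_zero_iff)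
  qed
  have "((\<lambda>h. \<Sum>k\<in>UNIV. ?p (t - h) $ i $ k * (?q h $ k $ j / h)) \<longlongrightarrow> (?p t ** Q) $ i $ j) (at_right 0)"
    unfolding matrix_matrix_mult_def vec_lambda_beta
    by (intro tendsto_sum tendsto_mult left_cont transition_generator)
  \<comment> \<open>The left quotient is written with the increment \<open>- h\<close>, so that a
    limit from the left at 0 becomes one from the right.\<close>
  moreover have "\<forall>\<^sub>F h in at_right 0.
      (\<Sum>k\<in>UNIV. ?p (t - h) $ i $ k * (?q h $ k $ j / h)) = (?p (t + - h) $ i $ j - ?p t $ i $ j) / (- h)"
    using small
  proof eventually_elim
    case (elim h)
    have "(\<Sum>k\<in>UNIV. ?p (t - h) $ i $ k * (?q h $ k $ j / h)) = (?p t $ i $ j - ?p (t - h) $ i $ j) / h"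
      using elim transition_diff[of "t - h" h i j] by (simp add: sum_divide_distrib)
    then show ?case by (simp add: minus_divide_left[symmetric] minus_divide_right diff_divide_distrib)
  qed
  ultimately have left: "((\<lambda>h. (?p (t + h) $ i $ j - ?p t $ i $ j) / h) \<longlongrightarrow> (?p t ** Q) $ i $ j) (at_left 0)"
    unfolding filterlim_at_left_to_right minus_zero by (rule Lim_transform_eventually)
  have "((\<lambda>h. \<Sum>k\<in>UNIV. ?p t $ i $ k * (?q h $ k $ j / h)) \<longlongrightarrow> (?p t ** Q) $ i $ j) (at_right 0)"
    unfolding matrix_matrix_mult_def vec_lambda_beta
    by (intro tendsto_sum tendsto_mult tendsto_const transition_generator)
  moreover have "\<forall>\<^sub>F h in at_right 0.
      (\<Sum>k\<in>UNIV. ?p t $ i $ k * (?q h $ k $ j / h)) = (?p (t + h) $ i $ j - ?p t $ i $ j) / h"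
    using small
  proof eventually_elim
    case (elim h)
    then show ?case using assms transition_diff[of t h i j] by (simp add: sum_divide_distrib)
  qed
  ultimately have "((\<lambda>h. (?p (t + h) $ i $ j - ?p t $ i $ j) / h) \<longlongrightarrow> (?p t ** Q) $ i $ j) (at_right 0)"
    by (rule Lim_transform_eventually)
  with left show ?thesis unfolding DERIV_def by (simp add: filterlim_at_split)
qed

text \<open>Uniqueness applies on the closed interval: continuity at 0 comes from
  \<open>transition_tendsto_0\<close>, and at positive times from differentiability.\<close>

lemma transition_eq_mexp:
  assumes "0 \<le> t"
  shows "transition t = mexp (t *\<^sub>R Q)"
proof (cases "t = 0")
  case True
  then show ?thesis using transition_0 mexp_0[of Q] by simp
next
  case False
  show ?thesis
  proof (rule linear_ode_unique[where F = transition, OF transition_0 assms])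
    show "continuous_on {0..t} (\<lambda>t. transition t $ i $ j)" for i j
      unfolding continuous_on_def
    proof
      fix s assume "s \<in> {0..t}"
      show "((\<lambda>t. transition t $ i $ j) \<longlongrightarrow> transition s $ i $ j) (at s within {0..t})"
      proof (cases "s = 0")
        case True
        have "((\<lambda>h. transition h $ i $ j) \<longlongrightarrow> mat 1 $ i $ j) (at_right 0)"
          using transition_tendsto_0[of i j] by (simp add: LIM_zero_iff)
        then show ?thesis
          using True False assms by (simp add: transition_0 at_within_Icc_at_right)
      next
        case False
        then have "isCont (\<lambda>t. transition t $ i $ j) s"
          using \<open>s \<in> {0..t}\<close> by (intro DERIV_isCont[OF DERIV_transition]) simp
        then show ?thesis unfolding isCont_def using tendsto_within_subset by blast
      qed
    qed
  qed (rule DERIV_transition)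
qed

text \<open>Right continuity makes \<open>X\<close> the pointwise limit of processes that are constant in time on
  intervals of length \<open>1 / (n + 1)\<close>, hence jointly measurable.\<close>

lemma measurable_occupation:
  "(\<lambda>(t, \<omega>). indicat_real {Some j} (X t \<omega>) * indicator {0..} t) \<in> borel_measurable (lborel \<Otimes>\<^sub>M P i)"
proof (rule borel_measurable_LIMSEQ_metric)
  \<comment> \<open>\<open>max 0\<close> makes every integer \<open>k\<close> give an admissible
    time for \<open>random_variable\<close>; for nonnegative times it changes nothing.\<close>
  let ?s = "\<lambda>n k. max 0 ((of_int k + 1) / real (Suc n))"
  let ?f = "\<lambda>n z. indicat_real {Some j} (X (?s n \<lfloor>real (Suc n) * fst z\<rfloor>) (snd z)) * indicator {0..} (fst z)"
  show "?f n \<in> borel_measurable (lborel \<Otimes>\<^sub>M P i)" for n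
  proof -
    \<comment> \<open>For a fixed integer only the sample point matters. The floor takes countably
      many values, so these measurable pieces can be glued.\<close>
    have "(\<lambda>z. X (?s n k) (snd z)) \<in> measurable (lborel \<Otimes>\<^sub>M P i) (count_space UNIV)" for k :: int
      by (intro measurable_compose[OF measurable_snd random_variable]) simp
    then have "(\<lambda>z. X (?s n \<lfloor>real (Suc n) * fst z\<rfloor>) (snd z)) \<in>
        measurable (lborel \<Otimes>\<^sub>M P i) (count_space UNIV)"
      by (rule measurable_compose_countable) measurable
    then have [measurable]: "(\<lambda>z. indicat_real {Some j} (X (?s n \<lfloor>real (Suc n) * fst z\<rfloor>) (snd z))) \<in>
        borel_measurable (lborel \<Otimes>\<^sub>M P i)"
      by (rule measurable_compose) simp
    show ?thesis by measurable
  qed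
  fix z :: "real \<times> 'w" assume "z \<in> space (lborel \<Otimes>\<^sub>M P i)"
  then have \<omega>: "snd z \<in> space (P i)" by (auto simp: space_pair_measure)
  show "(\<lambda>n. ?f n z) \<longlonglongrightarrow> (case z of (t, \<omega>) \<Rightarrow> indicat_real {Some j} (X t \<omega>) * indicator {0..} t)"
  proof (cases "0 \<le> fst z")
    case True
    have "\<forall>\<^sub>F n in sequentially.
        X ((of_int \<lfloor>real (Suc n) * fst z\<rfloor> + 1) / real (Suc n)) (snd z) = X (fst z) (snd z)"
      using right_continuous[OF True \<omega>] tendsto_grid_from_right by (rule eventually_compose_filterlim)
    then have "\<forall>\<^sub>F n in sequentially. ?f n z = indicat_real {Some j} (X (fst z) (snd z)) * indicator {0..} (fst z)"
    proof eventually_elim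
      case (elim n)
      have "0 \<le> (of_int \<lfloor>real (Suc n) * fst z\<rfloor> + 1) / real (Suc n)"
        using True by (intro divide_nonneg_nonneg) (auto intro!: add_nonneg_nonneg)
      then show ?case using elim by (simp only: max_absorb2)
    qed
    then show ?thesis by (simp add: case_prod_beta tendsto_eventually)
  qed (simp add: case_prod_beta)
qed

text \<open>After Tonelli the inner integral is the probability of being in \<open>j\<close> at time
  \<open>t\<close>. For a general generator both sides may be infinite; finiteness for trees comes
  from \<open>nn_integral_mexp\<close>.\<close>

lemma expected_occupation_time:
  "(\<integral>\<^sup>+\<omega>. (\<integral>\<^sup>+t\<in>{0..}. indicator {Some j} (X t \<omega>) \<partial>lborel) \<partial>P i) =
    (\<integral>\<^sup>+t\<in>{0..}. ennreal (mexp (t *\<^sub>R Q) $ i $ j) \<partial>lborel)"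
proof -
  interpret P: prob_space "P i" by (rule prob)
  interpret pair_sigma_finite lborel "P i" ..
  let ?h = "\<lambda>t \<omega>. indicator {Some j} (X t \<omega>) * indicator {0..} t :: ennreal"
  have "case_prod ?h = (\<lambda>z. ennreal (case z of (t, \<omega>) \<Rightarrow> indicat_real {Some j} (X t \<omega>) * indicator {0..} t))"
    by (auto simp: fun_eq_iff indicator_def)
  then have "case_prod ?h \<in> borel_measurable (lborel \<Otimes>\<^sub>M P i)"
    using measurable_occupation by simp
  then have "(\<integral>\<^sup>+\<omega>. (\<integral>\<^sup>+t. ?h t \<omega> \<partial>lborel) \<partial>P i) = (\<integral>\<^sup>+t. (\<integral>\<^sup>+\<omega>. ?h t \<omega> \<partial>P i) \<partial>lborel)"
    by (rule Fubini')
  also have "\<dots> = (\<integral>\<^sup>+t. ennreal (mexp (t *\<^sub>R Q) $ i $ j) * indicator {0..} t \<partial>lborel)"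
  proof (rule nn_integral_cong)
    fix t :: real
    show "(\<integral>\<^sup>+\<omega>. ?h t \<omega> \<partial>P i) = ennreal (mexp (t *\<^sub>R Q) $ i $ j) * indicator {0..} t"
    proof (cases "0 \<le> t")
      case True
      let ?A = "{\<omega> \<in> space (P i). X t \<omega> = Some j}"
      have "(\<integral>\<^sup>+\<omega>. ?h t \<omega> \<partial>P i) = (\<integral>\<^sup>+\<omega>. indicator ?A \<omega> \<partial>P i)"
        using True by (intro nn_integral_cong) (auto simp: indicator_def)
      also have "\<dots> = emeasure (P i) ?A" using sets_event[OF True] by simp
      also have "\<dots> = ennreal (transition t $ i $ j)"
        by (simp add: transition_def P.emeasure_eq_measure)
      finally show ?thesis using True transition_eq_mexp[OF True] by simp
    qed simp
  qed
  finally show ?thesis .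
qed

end

theorem proposition2p2:
  fixes T :: "('v::finite \<times> 'v) set" and r :: 'v and w :: "nat \<Rightarrow> real"
    and U Q :: "real^'v^'v"
  assumes "is_tree T"
    and "level_weight T r w"
    and "U = tree_matrix T r w"
    and "Q = tree_q_matrix T r w"
  shows "set_integrable lborel {0..} (\<lambda>t. mexp (t *\<^sub>R Q)) \<and>
    U = (LINT t:{0..}|lborel. mexp (t *\<^sub>R Q)) \<and>
    (\<forall>(P :: 'v \<Rightarrow> 'w measure) X \<zeta>. ctmc P X \<zeta> Q \<longrightarrow>
      (\<forall>i j. ennreal (U $ i $ j) =
        (\<integral>\<^sup>+\<omega>. (\<integral>\<^sup>+t\<in>{0..}. indicator {Some j} (X t \<omega>) \<partial>lborel) \<partial>P i)))"
proof -
  interpret weighted_tree T r w by unfold_locales (use assms in auto)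
  \<comment> \<open>These three facts are all that the analytic part uses about the tree.\<close>
  have inverse: "Q ** U = - mat 1" and pos: "0 < U $ i $ j"
    and off: "i \<noteq> j \<Longrightarrow> 0 \<le> Q $ i $ j" for i j
    using assms(3,4) tree_q_matrix_mult_tree_matrix tree_matrix_pos tree_q_matrix_off_diagonal by auto
  have "has_bochner_integral lborel (\<lambda>t. indicator {0..} t *\<^sub>R mexp (t *\<^sub>R Q)) U"
    by (rule has_bochner_integral_mexp[OF off pos inverse])
  moreover have "ennreal (U $ i $ j) =
      (\<integral>\<^sup>+\<omega>. (\<integral>\<^sup>+t\<in>{0..}. indicator {Some j} (X t \<omega>) \<partial>lborel) \<partial>P i)"
    if "ctmc P X \<zeta> Q" for P :: "'v \<Rightarrow> 'w measure" and X \<zeta> i j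
    unfolding ctmc.expected_occupation_time[OF that]
    by (rule nn_integral_mexp[OF off pos inverse, symmetric])
  ultimately show ?thesis
    by (auto simp: has_bochner_integral_iff set_integrable_def set_lebesgue_integral_def)
qed

end
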